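(* Consider the single-agent contract problem with safety inspections described in the context, and suppose that $c_1<\dots<c_n$, $R_1<\dots<R_n$ (Assumption 1) and $\max_i(R_i-c_i)>\kappa_S$ (Assumption 2). Let $(\gamma^*,\beta^* )$ be an optimal linear contract. 1. Suppose the principal's cost of inspection $\kappa_I$ increases to some $\kappa_I'>\kappa_I$ (all other data unchanged), and let $(\gamma'^*,\beta'^* )$ denote an optimal linear contract under this new setting. Then $\gamma'^*\ge\gamma^*$ and $\beta'^*\le\beta^*$. 2. Suppose the agent's cost of complying with safety measures $\kappa_S$ increases to some $\kappa_S'>\kappa_S$ (all other data unchanged), and let $(\gamma''^*,\beta''^* )$ denote an optimal linear contract under this new setting. Then $\gamma''^*\ge\gamma^*$.
   Context: Single-agent model. An agent chooses an action $(a_i,s)$ with $i\in[n]:=\{1,\dots,n\}$ and $s\in\{0,1\}$. Actions with $s=1$ are called safe, actions with $s=0$ unsafe. Effort $a_i$ costs the agent $c_i\ge 0$ and taking $s=1$ costs an additional $\kappa_S\ge 0$. Effort $a_i$ has expected (nonnegative) reward $R_i\ge 0$ for the principal when the action is safe. When the action is unsafe, negative side effects (reward $-\infty$) occur with probability $\alpha\in(0,1]$. A linear contract is a pair $(\gamma,\beta)\in[0,1]^2$: $\gamma$ is the fraction of the reward paid to the agent (nothing is paid if side effects occur), and $\beta$ is the probability of an inspection that reveals $s$ (nothing is paid if the inspection reveals an unsafe action; inspection is independent of side effects). An inspection costs the principal $\kappa_I$. The agent's expected utility under $(\gamma,\beta)$ is $$\mathcal U_a(a_i,1)=\gamma R_i-c_i-\kappa_S,\qquad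 \mathcal U_a(a_i,0)=(1-\beta)(1-\alpha)\gamma R_i-c_i .$$ The contract $(\gamma,\beta)$ implements the action $(a_i,s)$ if (IC) $\mathcal U_a(a_i,s)\ge \mathcal U_a(a_j,s')$ for all $j\in[n]$, $s'\in\{0,1\}$, and (IR) $\mathcal U_a(a_i,s)\ge 0$. If the agent takes the safe action $(a_i,1)$, the principal's expected utility is $\mathcal U_p(a_i,1)=(1-\gamma)R_i-\beta\kappa_I$; for unsafe actions it is $-\infty$. An optimal linear contract is a linear contract that, together with an action it implements, maximizes the principal's expected utility over all pairs consisting of a linear contract $(\gamma,\beta)$ and an action it implements. Optimal contracts need not be unique. Convention: for a given $\gamma$, the principal uses the smallest inspection probability $\beta=\beta(\gamma)$ for which $(\gamma,\beta)$ implements a safe action (increasing $\beta$ beyond it can only decrease the principal's utility).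
   Formalization: With ties the claim on γ can fail, so γ'* ≥ γ* and γ''* ≥ γ* are proved except when both shares γ are optimal before and after the change; set comparisons of the optima are added. Optimal contracts must implement a safe action with the smallest β, and κ_I ≥ 0. *)

theory Defs
  imports Complex_Main "HOL-Library.Extended_Real"
begin

record inspection_model =
  num :: nat                    (* n; the efforts are indexed by {1..n} *)
  reward :: "nat \<Rightarrow> real"       (* expected reward R_i under the safe action *)
  cost :: "nat \<Rightarrow> real"         (* c_i *)
  side_effect :: real           (* alpha, probability of side effects of an unsafe action *)
  safety_cost :: real           (* kappa_S *)
  inspection_cost :: real       (* kappa_I *)

definition valid_model :: "inspection_model \<Rightarrow> bool" where
  "valid_model M \<longleftrightarrow>
     1 \<le> num M \<and>
     (\<forall>i\<in>{1..num M}. 0 \<le> reward M i \<and> 0 \<le> cost M i) \<and>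
     0 < side_effect M \<and> side_effect M \<le> 1 \<and>
     0 \<le> safety_cost M \<and> 0 \<le> inspection_cost M"

definition assumption1 :: "inspection_model \<Rightarrow> bool" where
  "assumption1 M \<longleftrightarrow>
     strict_mono_on {1..num M} (cost M) \<and> strict_mono_on {1..num M} (reward M)"

definition assumption2 :: "inspection_model \<Rightarrow> bool" where
  "assumption2 M \<longleftrightarrow>
     safety_cost M < Max ((\<lambda>i. reward M i - cost M i) ` {1..num M})"

definition linear_contract :: "real \<Rightarrow> real \<Rightarrow> bool" where
  "linear_contract \<gamma> \<beta> \<longleftrightarrow> \<gamma> \<in> {0..1} \<and> \<beta> \<in> {0..1}"

(* An action is a pair (i, s) with i \<in> {1..n}; s = True means safe. *)

definition agent_utility :: "inspection_model \<Rightarrow> real \<Rightarrow> real \<Rightarrow> nat \<Rightarrow> bool \<Rightarrow> real" where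
  "agent_utility M \<gamma> \<beta> i s =
     (if s then \<gamma> * reward M i - cost M i - safety_cost M
      else (1 - \<beta>) * (1 - side_effect M) * \<gamma> * reward M i - cost M i)"

definition principal_utility :: "inspection_model \<Rightarrow> real \<Rightarrow> real \<Rightarrow> nat \<Rightarrow> bool \<Rightarrow> ereal" where
  "principal_utility M \<gamma> \<beta> i s =
     (if s then ereal ((1 - \<gamma>) * reward M i - \<beta> * inspection_cost M) else - \<infinity>)"

definition implements :: "inspection_model \<Rightarrow> real \<Rightarrow> real \<Rightarrow> nat \<Rightarrow> bool \<Rightarrow> bool" where
  "implements M \<gamma> \<beta> i s \<longleftrightarrow>
     i \<in> {1..num M} \<and>
     (\<forall>j\<in>{1..num M}. \<forall>s'. agent_utility M \<gamma> \<beta> j s' \<le> agent_utility M \<gamma> \<beta> i s) \<and>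
     0 \<le> agent_utility M \<gamma> \<beta> i s"

definition utility_maximizing :: "inspection_model \<Rightarrow> real \<Rightarrow> real \<Rightarrow> bool" where
  "utility_maximizing M \<gamma> \<beta> \<longleftrightarrow>
     linear_contract \<gamma> \<beta> \<and>
     (\<exists>i s. implements M \<gamma> \<beta> i s \<and>
        (\<forall>\<gamma>' \<beta>' j s'. linear_contract \<gamma>' \<beta>' \<and> implements M \<gamma>' \<beta>' j s' \<longrightarrow>
           principal_utility M \<gamma>' \<beta>' j s' \<le> principal_utility M \<gamma> \<beta> i s))"

definition smallest_inspection :: "inspection_model \<Rightarrow> real \<Rightarrow> real \<Rightarrow> bool" where
  "smallest_inspection M \<gamma> \<beta> \<longleftrightarrow>
     linear_contract \<gamma> \<beta> \<and> (\<exists>i. implements M \<gamma> \<beta> i True) \<and>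
     (\<forall>b. linear_contract \<gamma> b \<and> (\<exists>i. implements M \<gamma> b i True) \<longrightarrow> \<beta> \<le> b)"

(* The second conjunct is the convention beta = beta(gamma).  It has an effect only if
   inspections are free (inspection_cost M = 0), or if no safe action can be implemented
   at all, so that every implementable action gives the principal -infinity; in the
   latter case no contract counts as optimal. *)
definition optimal_contract :: "inspection_model \<Rightarrow> real \<Rightarrow> real \<Rightarrow> bool" where
  "optimal_contract M \<gamma> \<beta> \<longleftrightarrow> utility_maximizing M \<gamma> \<beta> \<and> smallest_inspection M \<gamma> \<beta>"

end

theory Submission
  imports Defs "HOL-Analysis.Elementary_Topology"
begin

text \<open>
  The agent's best payoff from a share \<open>x\<close> of the reward is \<open>S x = Max\<^sub>i (x R\<^sub>i - c\<^sub>i)\<close>, a convex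
  nondecreasing function. A safe action is implementable under \<open>(\<gamma>, \<beta>)\<close> iff \<open>S \<gamma> \<ge> \<kappa>\<^sub>S\<close> and
  \<open>S ((1 - \<beta>) (1 - \<alpha>) \<gamma>) \<le> S \<gamma> - \<kappa>\<^sub>S\<close>, and the principal's utility is \<open>G \<gamma> - \<beta>(\<gamma>) \<kappa>\<^sub>I\<close>, where neither
  \<open>S\<close> nor \<open>G\<close> depends on \<open>\<kappa>\<^sub>S\<close> and \<open>\<kappa>\<^sub>I\<close>. Convexity of \<open>S\<close> makes \<open>\<beta>(\<gamma>)\<close> nonincreasing in \<open>\<gamma>\<close>, and makes
  the rise of \<open>\<beta>(\<gamma>)\<close> caused by a larger \<open>\<kappa>\<^sub>S\<close> nonincreasing in \<open>\<gamma>\<close> as well. Both comparisons then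
  follow by exchanging the two optimal contracts.
\<close>

section \<open>The effort menu, with the safety and inspection costs as parameters\<close>

locale effort_menu =
  fixes n :: nat and R c :: "nat \<Rightarrow> real" and \<alpha> :: real
  assumes n_pos: "1 \<le> n"
    and R_nonneg: "\<And>i. i \<in> {1..n} \<Longrightarrow> 0 \<le> R i"
    and c_nonneg: "\<And>i. i \<in> {1..n} \<Longrightarrow> 0 \<le> c i"
    and alpha_pos: "0 < \<alpha>" and alpha_le_1: "\<alpha> \<le> 1"
begin

definition surplus :: "real \<Rightarrow> real" where
  "surplus x = Max ((\<lambda>i. x * R i - c i) ` {1..n})"

definition best_effort :: "real \<Rightarrow> nat \<Rightarrow> bool" where
  "best_effort \<gamma> i \<longleftrightarrow> i \<in> {1..n} \<and> \<gamma> * R i - c i = surplus \<gamma>"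

text \<open>Ties between best efforts go to the principal, since an optimal contract is chosen
  together with an action it implements.\<close>

definition gross :: "real \<Rightarrow> real" where
  "gross \<gamma> = Max ((\<lambda>i. (1 - \<gamma>) * R i) ` {i. best_effort \<gamma> i})"

definition safe_at :: "real \<Rightarrow> real \<Rightarrow> real \<Rightarrow> bool" where
  "safe_at \<kappa> \<gamma> \<beta> \<longleftrightarrow>
     \<gamma> \<in> {0..1} \<and> \<beta> \<in> {0..1} \<and> \<kappa> \<le> surplus \<gamma> \<and>
     surplus ((1 - \<beta>) * (1 - \<alpha>) * \<gamma>) \<le> surplus \<gamma> - \<kappa>"

definition least_safe :: "real \<Rightarrow> real \<Rightarrow> real \<Rightarrow> bool" where
  "least_safe \<kappa> \<gamma> \<beta> \<longleftrightarrow> safe_at \<kappa> \<gamma> \<beta> \<and> (\<forall>b. safe_at \<kappa> \<gamma> b \<longrightarrow> \<beta> \<le> b)"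

definition optimal :: "real \<Rightarrow> real \<Rightarrow> real \<Rightarrow> real \<Rightarrow> bool" where
  "optimal \<kappa> \<iota> \<gamma> \<beta> \<longleftrightarrow>
     least_safe \<kappa> \<gamma> \<beta> \<and>
     (\<forall>\<gamma>' \<beta>'. safe_at \<kappa> \<gamma>' \<beta>' \<longrightarrow> gross \<gamma>' - \<beta>' * \<iota> \<le> gross \<gamma> - \<beta> * \<iota>)"

section \<open>Monotonicity, Lipschitz bound and convexity of the surplus\<close>

lemma surplus_ge: "i \<in> {1..n} \<Longrightarrow> x * R i - c i \<le> surplus x"
  unfolding surplus_def by (rule Max_ge) auto

lemma surplus_le_iff: "surplus x \<le> y \<longleftrightarrow> (\<forall>i\<in>{1..n}. x * R i - c i \<le> y)"
  unfolding surplus_def using n_pos by (subst Max_le_iff) auto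

lemma best_effort_exists: obtains i where "best_effort x i"
proof -
  have "surplus x \<in> (\<lambda>i. x * R i - c i) ` {1..n}"
    unfolding surplus_def using n_pos by (intro Max_in) auto
  then show thesis using that unfolding best_effort_def by auto
qed

lemma best_effortD:
  assumes "best_effort x i"
  shows "i \<in> {1..n}" "surplus x = x * R i - c i" "0 \<le> R i"
  using assms R_nonneg unfolding best_effort_def by auto

lemma surplus_mono:
  assumes "x \<le> y" shows "surplus x \<le> surplus y"
proof -
  obtain i where i: "best_effort x i" by (rule best_effort_exists)
  have "x * R i \<le> y * R i"
    using best_effortD(3)[OF i] assms by (rule mult_right_mono[rotated])
  with best_effortD[OF i] surplus_ge[of i y] show ?thesis by linarith
qed

lemma surplus_0_le: "surplus 0 \<le> 0"
  using c_nonneg by (auto simp: surplus_le_iff)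

lemma surplus_lipschitz:
  assumes "x \<le> y" shows "surplus y \<le> surplus x + (y - x) * (\<Sum>i\<in>{1..n}. R i)"
proof -
  obtain i where i: "best_effort y i" by (rule best_effort_exists)
  have "R i \<le> (\<Sum>i\<in>{1..n}. R i)"
    using best_effortD(1)[OF i] R_nonneg by (intro member_le_sum) auto
  then have "(y - x) * R i \<le> (y - x) * (\<Sum>i\<in>{1..n}. R i)"
    using assms by (intro mult_left_mono) auto
  with best_effortD(2)[OF i] surplus_ge[OF best_effortD(1)[OF i], of x] show ?thesis
    by (simp add: left_diff_distrib)
qed

text \<open>Convexity of a maximum of affine functions, in interval form; a longer right-hand
  interval reduces to equal length \<open>d\<close> by monotonicity.\<close>

lemma surplus_increment:
  assumes "x' \<le> x" "x \<le> y" "x - x' \<le> y - y'"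
  shows "surplus x - surplus x' \<le> surplus y - surplus y'"
proof -
  define d where "d = x - x'"
  have d: "0 \<le> d" "x' = x - d" "y' \<le> y - d" using assms by (auto simp: d_def)
  obtain p where p: "best_effort (y - d) p" by (rule best_effort_exists)
  obtain q where q: "best_effort x q" by (rule best_effort_exists)
  note P = best_effortD[OF p] and Q = best_effortD[OF q]
  have "surplus x - surplus (x - d) \<le> surplus y - surplus (y - d)"
  \<comment> \<open>The efforts best at \<open>y - d\<close> and \<open>x\<close> are tested at the
    outer points: the one with the larger reward at \<open>y\<close>, the other at
    \<open>x - d\<close>. As \<open>x + (y - d) = y + (x - d)\<close>, this pairing cannot lower the
    total.\<close>
  proof (cases "R p \<le> R q")
    case True
    have "(y - x) * R p \<le> (y - x) * R q" using True assms by (intro mult_left_mono) auto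
    moreover have "(x - d) * R p - c p \<le> surplus (x - d)" "y * R q - c q \<le> surplus y"
      using P(1) Q(1) by (auto intro: surplus_ge)
    ultimately show ?thesis using P(2) Q(2) by (simp add: algebra_simps)
  next
    case False
    have "d * R q \<le> d * R p" using False d by (intro mult_left_mono) auto
    moreover have "(x - d) * R q - c q \<le> surplus (x - d)" "y * R p - c p \<le> surplus y"
      using P(1) Q(1) by (auto intro: surplus_ge)
    ultimately show ?thesis using P(2) Q(2) by (simp add: algebra_simps)
  qed
  moreover have "surplus y' \<le> surplus (y - d)" using d by (intro surplus_mono)
  ultimately show ?thesis using d by simp
qed

section \<open>Safe contracts and the least inspection probability\<close>

lemma deviation_share_bounds:
  assumes "b \<in> {0..1::real}"
  shows "0 \<le> (1 - b) * (1 - \<alpha>)" "(1 - b) * (1 - \<alpha>) \<le> 1"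
  using assms alpha_pos alpha_le_1 by (auto intro: mult_le_one)

text \<open>An unsafe deviation earns the share \<open>t * \<gamma>\<close>. The gap
  \<open>(1 - t) * \<gamma>\<close> to the safe share widens with \<open>\<gamma>\<close>, so by
  convexity deviating costs the agent no less surplus at a larger share.\<close>

lemma safe_at_mono_share:
  assumes "safe_at \<kappa> \<gamma> b" "\<gamma> \<le> \<gamma>'" "\<gamma>' \<le> 1"
  shows "safe_at \<kappa> \<gamma>' b"
proof -
  define t where "t = (1 - b) * (1 - \<alpha>)"
  have t: "0 \<le> t" "t \<le> 1"
    using assms(1) deviation_share_bounds unfolding safe_at_def t_def by auto
  have "(1 - t) * \<gamma> \<le> (1 - t) * \<gamma>'" "t * \<gamma> \<le> 1 * \<gamma>"
    using t assms unfolding safe_at_def by (intro mult_left_mono mult_right_mono; auto)+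
  then have "surplus \<gamma> - surplus (t * \<gamma>) \<le> surplus \<gamma>' - surplus (t * \<gamma>')"
    using assms(2) by (intro surplus_increment) (auto simp: algebra_simps)
  with surplus_mono[OF assms(2)] assms show ?thesis
    unfolding safe_at_def t_def by auto
qed

lemma safe_at_full_inspection:
  assumes "\<gamma> \<in> {0..1}" "\<kappa> \<le> surplus \<gamma>"
  shows "safe_at \<kappa> \<gamma> 1"
  using assms surplus_0_le unfolding safe_at_def by auto

text \<open>With the effort fixed, the maxima become finitely many weak polynomial inequalities,
  suited to compactness arguments and to matching IC and IR.\<close>

lemma safe_at_iff_best:
  assumes "best_effort \<gamma> i"
  shows "safe_at \<kappa> \<gamma> b \<longleftrightarrow> \<gamma> \<in> {0..1} \<and> b \<in> {0..1} \<and> 0 \<le> \<gamma> * R i - c i - \<kappa> \<and>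
     (\<forall>j\<in>{1..n}. (1 - b) * (1 - \<alpha>) * \<gamma> * R j - c j \<le> \<gamma> * R i - c i - \<kappa>)"
  using best_effortD(2)[OF assms] unfolding safe_at_def surplus_le_iff by auto

lemma least_safe_exists:
  assumes "safe_at \<kappa> \<gamma> b0"
  obtains b where "least_safe \<kappa> \<gamma> b"
proof -
  obtain i where i: "best_effort \<gamma> i" by (rule best_effort_exists)
  define C where "C = {0..1} \<inter> {b. \<forall>j\<in>{1..n}. (1 - b) * (1 - \<alpha>) * \<gamma> * R j - c j \<le> \<gamma> * R i - c i - \<kappa>}"
  have "closed {b. \<forall>j\<in>{1..n}. (1 - b) * (1 - \<alpha>) * \<gamma> * R j - c j \<le> \<gamma> * R i - c i - \<kappa>}"
    unfolding Ball_def
    by (intro closed_Collect_all closed_Collect_imp closed_Collect_le open_Collect_const continuous_intros)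
  then have "compact C" unfolding C_def by (intro compact_Int_closed) auto
  moreover have C: "b \<in> C \<longleftrightarrow> safe_at \<kappa> \<gamma> b" for b
    using assms i unfolding C_def by (auto simp: safe_at_iff_best)
  ultimately obtain b where "b \<in> C" "\<forall>b'\<in>C. b \<le> b'"
    using compact_attains_inf[of C] assms by blast
  then show thesis using that C unfolding least_safe_def by auto
qed

text \<open>Slack in the deviation constraint would, by the Lipschitz bound, allow slightly less
  inspection.\<close>

lemma least_safe_binding:
  assumes "least_safe \<kappa> \<gamma> b" "b \<noteq> 0"
  shows "surplus \<gamma> - \<kappa> \<le> surplus ((1 - b) * (1 - \<alpha>) * \<gamma>)"
proof (rule ccontr)
  assume neg: "\<not> ?thesis"
  define K where "K = (\<Sum>i\<in>{1..n}. R i)"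
  define \<delta> where "\<delta> = surplus \<gamma> - \<kappa> - surplus ((1 - b) * (1 - \<alpha>) * \<gamma>)"
  \<comment> \<open>Lowering \<open>b\<close> by at most \<open>\<delta> / (K + 1)\<close> raises
    the deviation surplus by at most \<open>\<delta>\<close>; the \<open>+ 1\<close> covers
    \<open>K = 0\<close>, and \<open>max 0\<close> keeps \<open>b'\<close> a probability.\<close>
  define b' where "b' = max 0 (b - \<delta> / (K + 1))"
  have K: "0 \<le> K" unfolding K_def using R_nonneg by (intro sum_nonneg) auto
  have \<delta>: "0 < \<delta>" using neg unfolding \<delta>_def by auto
  have b: "0 < b" "b \<le> 1" "0 \<le> \<gamma>" "\<gamma> \<le> 1" "\<kappa> \<le> surplus \<gamma>"
    using assms unfolding least_safe_def safe_at_def by auto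
  have "0 < \<delta> / (K + 1)" using K \<delta> by auto
  then have b': "0 \<le> b'" "b' < b" "b - b' \<le> \<delta> / (K + 1)" using b unfolding b'_def by auto
  define u where "u = (1 - \<alpha>) * \<gamma>"
  have u: "0 \<le> u" "u \<le> 1"
    unfolding u_def using b alpha_pos alpha_le_1 by (auto intro: mult_le_one)
  have "(b - b') * u \<le> b - b'" using mult_left_mono[OF u(2), of "b - b'"] b' by simp
  then have "(b - b') * u * K \<le> \<delta> / (K + 1) * K"
    using b'(3) K by (intro mult_right_mono) linarith+
  also have "\<dots> \<le> \<delta>" using K \<delta> by (simp add: field_simps)
  finally have small: "(b - b') * u * K \<le> \<delta>" .
  have le: "(1 - b) * u \<le> (1 - b') * u" using b' u by (intro mult_right_mono) auto
  have "surplus ((1 - b') * u) \<le> surplus ((1 - b) * u) + (b - b') * u * K"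
    using surplus_lipschitz[OF le] unfolding K_def by (simp add: algebra_simps)
  then have "surplus ((1 - b') * u) \<le> surplus \<gamma> - \<kappa>"
    using small unfolding \<delta>_def u_def by (simp add: mult.assoc)
  then have "safe_at \<kappa> \<gamma> b'"
    using b b' unfolding safe_at_def u_def by (simp add: mult.assoc)
  with assms(1) b' show False unfolding least_safe_def by force
qed

text \<open>The probability \<open>d + (b' - b)\<close> already suffices for \<open>\<kappa>'\<close> at the larger share: since the constraint
  binds at \<open>b\<close>, raising \<open>b\<close> to \<open>b'\<close> lowers the deviation surplus by at least \<open>\<kappa>' - \<kappa>\<close>, and by convexity
  the same raise lowers it at least as much at \<open>\<gamma>'\<close>.\<close>

lemma least_safe_decreasing_differences:
  assumes "\<kappa> \<le> \<kappa>'" "\<gamma> \<le> \<gamma>'"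
    and b: "least_safe \<kappa> \<gamma> b" and b': "least_safe \<kappa>' \<gamma> b'"
    and d: "least_safe \<kappa> \<gamma>' d" and d': "least_safe \<kappa>' \<gamma>' d'"
  shows "d' - d \<le> b' - b"
proof -
  have range: "0 \<le> b" "b \<le> 1" "0 \<le> b'" "b' \<le> 1" "0 \<le> d" "d \<le> 1" "0 \<le> \<gamma>" "\<gamma>' \<le> 1"
      "\<kappa> \<le> surplus \<gamma>" "\<kappa>' \<le> surplus \<gamma>'"
    using b b' d d' unfolding least_safe_def safe_at_def by auto
  have "safe_at \<kappa> \<gamma> b'" using b' \<open>\<kappa> \<le> \<kappa>'\<close> unfolding least_safe_def safe_at_def by auto
  then have bb': "b \<le> b'" using b unfolding least_safe_def by auto
  have db: "d \<le> b" using safe_at_mono_share[of \<kappa> \<gamma> b \<gamma>'] b d assms(2) range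
    unfolding least_safe_def by auto
  define e where "e = d + (b' - b)"
  have e: "0 \<le> e" "e \<le> 1" using bb' db range unfolding e_def by auto
  have "safe_at \<kappa>' \<gamma>' e"
  \<comment> \<open>At \<open>b = 0\<close> the constraint need not bind; but then
    \<open>d = 0\<close> and \<open>e = b'\<close>, which stays safe at the larger share.\<close>
  proof (cases "b = 0")
    case True
    then have "e = b'" using db range unfolding e_def by auto
    then show ?thesis using safe_at_mono_share b' assms(2) range
      unfolding least_safe_def by blast
  next
    case False
    define a where "a = 1 - \<alpha>"
    have a: "0 \<le> a" using alpha_le_1 unfolding a_def by auto
    have "surplus \<gamma> - \<kappa> \<le> surplus ((1 - b) * a * \<gamma>)"
      using least_safe_binding[OF b False] unfolding a_def .
    moreover have "surplus ((1 - b') * a * \<gamma>) \<le> surplus \<gamma> - \<kappa>'"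
      using b' unfolding least_safe_def safe_at_def a_def by auto
    moreover have "surplus ((1 - b) * a * \<gamma>) - surplus ((1 - b') * a * \<gamma>)
        \<le> surplus ((1 - d) * a * \<gamma>') - surplus ((1 - e) * a * \<gamma>')"
    proof (rule surplus_increment)
      show "(1 - b') * a * \<gamma> \<le> (1 - b) * a * \<gamma>"
        using bb' a range by (intro mult_right_mono) auto
      show "(1 - b) * a * \<gamma> \<le> (1 - d) * a * \<gamma>'"
        using db a range assms(2) by (intro mult_mono) auto
      have "(b' - b) * a * \<gamma> \<le> (b' - b) * a * \<gamma>'"
        using bb' a assms(2) by (intro mult_left_mono) auto
      then show "(1 - b) * a * \<gamma> - (1 - b') * a * \<gamma> \<le> (1 - d) * a * \<gamma>' - (1 - e) * a * \<gamma>'"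
        unfolding e_def by (simp add: algebra_simps)
    qed
    moreover have "surplus ((1 - d) * a * \<gamma>') \<le> surplus \<gamma>' - \<kappa>"
      using d unfolding least_safe_def safe_at_def a_def by auto
    ultimately have "surplus ((1 - e) * a * \<gamma>') \<le> surplus \<gamma>' - \<kappa>'" by linarith
    then show ?thesis using e range assms(2) unfolding safe_at_def a_def by auto
  qed
  then have "d' \<le> e" using d' unfolding least_safe_def by auto
  then show ?thesis unfolding e_def by simp
qed

section \<open>Existence of optimal contracts\<close>

lemma finite_best_effort: "finite {i. best_effort \<gamma> i}"
  by (rule finite_subset[of _ "{1..n}"]) (auto simp: best_effort_def)

lemma gross_ge: "best_effort \<gamma> i \<Longrightarrow> (1 - \<gamma>) * R i \<le> gross \<gamma>"
  unfolding gross_def using finite_best_effort by (intro Max_ge) auto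

lemma gross_attained: obtains i where "best_effort \<gamma> i" "gross \<gamma> = (1 - \<gamma>) * R i"
proof -
  obtain i where "best_effort \<gamma> i" by (rule best_effort_exists)
  then have "gross \<gamma> \<in> (\<lambda>i. (1 - \<gamma>) * R i) ` {i. best_effort \<gamma> i}"
    unfolding gross_def using finite_best_effort by (intro Max_in) auto
  then show thesis using that by auto
qed

text \<open>Passing to the least safe probability at the same share cannot raise the inspection
  bill. This restores the convention, which a maximiser may violate when
  \<open>\<iota> = 0\<close>.\<close>

lemma optimal_of_maximal:
  assumes "safe_at \<kappa> \<gamma> \<beta>" "0 \<le> \<iota>"
    and max: "\<And>\<gamma>' \<beta>'. safe_at \<kappa> \<gamma>' \<beta>' \<Longrightarrow> gross \<gamma>' - \<beta>' * \<iota> \<le> gross \<gamma> - \<beta> * \<iota>"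
  obtains \<gamma>\<^sub>0 \<beta>\<^sub>0 where "optimal \<kappa> \<iota> \<gamma>\<^sub>0 \<beta>\<^sub>0"
proof -
  obtain b where b: "least_safe \<kappa> \<gamma> b" using assms(1) by (rule least_safe_exists)
  then have "b * \<iota> \<le> \<beta> * \<iota>" using assms(1,2) unfolding least_safe_def by (intro mult_right_mono) auto
  then have "optimal \<kappa> \<iota> \<gamma> b" unfolding optimal_def using b max by force
  then show thesis using that by blast
qed

lemma optimal_exists:
  assumes "\<kappa> \<le> surplus 1" "0 \<le> \<iota>"
  obtains \<gamma> \<beta> where "optimal \<kappa> \<iota> \<gamma> \<beta>"
proof -
  \<comment> \<open>\<open>gross\<close> can jump where the best effort changes, so each effort is
    maximised separately: \<open>f i\<close> is continuous on the compact set \<open>C i\<close>.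
    The best of these finitely many maximisers is then taken.\<close>
  define C where "C i = {p. best_effort (fst p) i \<and> safe_at \<kappa> (fst p) (snd p)}" for i
  define f where "f i p = (1 - fst p) * R i - snd p * \<iota>" for i and p :: "real \<times> real"
  have attained: "\<exists>p\<in>C i. \<forall>q\<in>C i. f i q \<le> f i p" if "C i \<noteq> {}" for i
  proof -
    have i: "i \<in> {1..n}" using that unfolding C_def best_effort_def by auto
    have best: "best_effort \<gamma> i \<longleftrightarrow> (\<forall>j\<in>{1..n}. \<gamma> * R j - c j \<le> \<gamma> * R i - c i)" for \<gamma>
      using surplus_le_iff[of \<gamma> "\<gamma> * R i - c i"] surplus_ge[OF i, of \<gamma>] i
      unfolding best_effort_def by auto
    have "C i = ({0..1} \<times> {0..1}) \<inter> {p. (\<forall>j\<in>{1..n}. fst p * R j - c j \<le> fst p * R i - c i) \<and>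
        0 \<le> fst p * R i - c i - \<kappa> \<and>
        (\<forall>j\<in>{1..n}. (1 - snd p) * (1 - \<alpha>) * fst p * R j - c j \<le> fst p * R i - c i - \<kappa>)}"
      unfolding C_def best[symmetric] by (auto simp: safe_at_iff_best)
    moreover have "compact \<dots>"
      unfolding Ball_def
      by (intro compact_Int_closed compact_Times compact_Icc closed_Collect_conj closed_Collect_all
          closed_Collect_imp closed_Collect_le open_Collect_const continuous_intros)
    ultimately have "compact (C i)" by simp
    moreover have "continuous_on (C i) (f i)" unfolding f_def by (intro continuous_intros)
    ultimately show ?thesis using continuous_attains_sup that by blast
  qed
  define I where "I = {i. C i \<noteq> {}}"
  have "\<forall>i. \<exists>p. i \<in> I \<longrightarrow> p \<in> C i \<and> (\<forall>q\<in>C i. f i q \<le> f i p)"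
    using attained unfolding I_def by blast
  then obtain p where p: "\<And>i. i \<in> I \<Longrightarrow> p i \<in> C i \<and> (\<forall>q\<in>C i. f i q \<le> f i (p i))"
    unfolding choice_iff by blast
  have finI: "finite I"
    unfolding I_def C_def best_effort_def by (rule finite_subset[of _ "{1..n}"]) auto
  \<comment> \<open>Paying out the whole reward and always inspecting is safe because
    \<open>\<kappa> \<le> surplus 1\<close>, so some \<open>C i\<close> is nonempty.\<close>
  obtain i0 where "best_effort 1 i0" by (rule best_effort_exists)
  then have "(1, 1) \<in> C i0" using safe_at_full_inspection[of 1 \<kappa>] assms(1) unfolding C_def by auto
  then have "I \<noteq> {}" unfolding I_def by auto
  define m where "m = Max ((\<lambda>i. f i (p i)) ` I)"
  have "m \<in> (\<lambda>i. f i (p i)) ` I" unfolding m_def using finI \<open>I \<noteq> {}\<close> by (intro Max_in) auto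
  then obtain k where "k \<in> I" "f k (p k) = m" by auto
  moreover have "f i (p i) \<le> m" if "i \<in> I" for i
    unfolding m_def using finI that by (intro Max_ge) auto
  ultimately have k: "k \<in> I" "\<And>i. i \<in> I \<Longrightarrow> f i (p i) \<le> f k (p k)" by auto
  have pk: "best_effort (fst (p k)) k" "safe_at \<kappa> (fst (p k)) (snd (p k))"
    using p[OF k(1)] unfolding C_def by auto
  show thesis
  proof (rule optimal_of_maximal[OF pk(2) assms(2)])
    fix \<gamma>' \<beta>' assume safe: "safe_at \<kappa> \<gamma>' \<beta>'"
    obtain j where j: "best_effort \<gamma>' j" "gross \<gamma>' = (1 - \<gamma>') * R j" by (rule gross_attained)
    have q: "(\<gamma>', \<beta>') \<in> C j" using j safe unfolding C_def by auto
    then have "j \<in> I" unfolding I_def by auto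
    have "gross \<gamma>' - \<beta>' * \<iota> = f j (\<gamma>', \<beta>')" using j unfolding f_def by simp
    also have "\<dots> \<le> f k (p k)" using p[OF \<open>j \<in> I\<close>] q k(2)[OF \<open>j \<in> I\<close>] by force
    also have "\<dots> \<le> gross (fst (p k)) - snd (p k) * \<iota>"
      using gross_ge[OF pk(1)] unfolding f_def by simp
    finally show "gross \<gamma>' - \<beta>' * \<iota> \<le> gross (fst (p k)) - snd (p k) * \<iota>" .
  qed (use that in blast)
qed

section \<open>Exchange arguments for the two cost increases\<close>

lemma optimal_inspection_cost_increase:
  assumes "\<iota> < \<iota>'" and opt: "optimal \<kappa> \<iota> \<gamma> \<beta>" and opt': "optimal \<kappa> \<iota>' \<gamma>' \<beta>'"
  shows "\<beta>' \<le> \<beta>" "\<gamma> \<le> \<gamma>' \<or> optimal \<kappa> \<iota> \<gamma>' \<beta>' \<and> optimal \<kappa> \<iota>' \<gamma> \<beta>"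
proof -
  have v: "gross \<gamma>' - \<beta>' * \<iota> \<le> gross \<gamma> - \<beta> * \<iota>" "gross \<gamma> - \<beta> * \<iota>' \<le> gross \<gamma>' - \<beta>' * \<iota>'"
    using opt opt' unfolding optimal_def least_safe_def by blast+
  \<comment> \<open>Adding the two optimality inequalities cancels \<open>gross\<close>.\<close>
  then have "0 \<le> (\<beta> - \<beta>') * (\<iota>' - \<iota>)" by (simp add: algebra_simps)
  then show le: "\<beta>' \<le> \<beta>" using assms(1) by (simp add: zero_le_mult_iff)
  show "\<gamma> \<le> \<gamma>' \<or> optimal \<kappa> \<iota> \<gamma>' \<beta>' \<and> optimal \<kappa> \<iota>' \<gamma> \<beta>"
  proof (rule disj_imp[THEN iffD2], rule impI)
    assume "\<not> \<gamma> \<le> \<gamma>'"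
    \<comment> \<open>Since \<open>\<beta>'\<close> stays safe at the larger share
      \<open>\<gamma>\<close>, minimality forces \<open>\<beta> = \<beta>'\<close>. Then
      \<open>gross\<close> agrees too, and each contract is optimal under both costs.\<close>
    then have "safe_at \<kappa> \<gamma> \<beta>'"
      using safe_at_mono_share[of \<kappa> \<gamma>' \<beta>' \<gamma>] opt opt'
      unfolding optimal_def least_safe_def safe_at_def[of _ \<gamma> \<beta>] by auto
    then have "\<beta> = \<beta>'" using opt le unfolding optimal_def least_safe_def by force
    moreover from this have "gross \<gamma>' = gross \<gamma>" using v by simp
    ultimately show "optimal \<kappa> \<iota> \<gamma>' \<beta>' \<and> optimal \<kappa> \<iota>' \<gamma> \<beta>"
      using opt opt' unfolding optimal_def by simp
  qed
qed

text \<open>If \<open>\<gamma>' < \<gamma>\<close>, each optimum is tested against the other share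
  with the least probability required there at its own safety cost. Decreasing differences and
  \<open>0 \<le> \<iota>\<close> reverse the sum of the two optimality inequalities, so both are
  equalities.\<close>

lemma optimal_safety_cost_increase:
  assumes "\<kappa> \<le> \<kappa>'" "0 \<le> \<iota>" and opt: "optimal \<kappa> \<iota> \<gamma> \<beta>" and opt': "optimal \<kappa>' \<iota> \<gamma>' \<beta>'"
  shows "\<gamma> \<le> \<gamma>' \<or> (\<exists>b. optimal \<kappa> \<iota> \<gamma>' b) \<and> (\<exists>b. optimal \<kappa>' \<iota> \<gamma> b)"
proof (rule disj_imp[THEN iffD2], rule impI)
  assume "\<not> \<gamma> \<le> \<gamma>'"
  then have less: "\<gamma>' \<le> \<gamma>" by simp
  have L: "least_safe \<kappa> \<gamma> \<beta>" "least_safe \<kappa>' \<gamma>' \<beta>'"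
    using opt opt' unfolding optimal_def by auto
  have "safe_at \<kappa> \<gamma>' \<beta>'"
    using L(2) assms(1) unfolding least_safe_def safe_at_def by auto
  then obtain b where b: "least_safe \<kappa> \<gamma>' b" by (rule least_safe_exists)
  have "safe_at \<kappa>' \<gamma> \<beta>'"
    using safe_at_mono_share[of \<kappa>' \<gamma>' \<beta>' \<gamma>] less L
    unfolding least_safe_def safe_at_def[of _ \<gamma> \<beta>] by auto
  then obtain d where d: "least_safe \<kappa>' \<gamma> d" by (rule least_safe_exists)
  have "(d - \<beta>) * \<iota> \<le> (\<beta>' - b) * \<iota>"
    using least_safe_decreasing_differences[OF assms(1) less b L(2) L(1) d] assms(2)
    by (rule mult_right_mono)
  moreover have "gross \<gamma>' - b * \<iota> \<le> gross \<gamma> - \<beta> * \<iota>" "gross \<gamma> - d * \<iota> \<le> gross \<gamma>' - \<beta>' * \<iota>"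
    using opt opt' b d unfolding optimal_def least_safe_def by blast+
  ultimately have "gross \<gamma>' - b * \<iota> = gross \<gamma> - \<beta> * \<iota>" "gross \<gamma> - d * \<iota> = gross \<gamma>' - \<beta>' * \<iota>"
    by (auto simp: algebra_simps)
  then have "optimal \<kappa> \<iota> \<gamma>' b" "optimal \<kappa>' \<iota> \<gamma> d"
    using opt opt' b d unfolding optimal_def by auto
  then show "(\<exists>b. optimal \<kappa> \<iota> \<gamma>' b) \<and> (\<exists>b. optimal \<kappa>' \<iota> \<gamma> b)" by blast
qed

section \<open>Translation from the model records\<close>

lemma implements_safe_iff:
  assumes "num M = n" "reward M = R" "cost M = c" "side_effect M = \<alpha>"
  shows "linear_contract \<gamma> \<beta> \<and> implements M \<gamma> \<beta> i True \<longleftrightarrow>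
     best_effort \<gamma> i \<and> safe_at (safety_cost M) \<gamma> \<beta>"
proof (cases "i \<in> {1..n}")
  case True
  have best: "best_effort \<gamma> i \<longleftrightarrow> (\<forall>j\<in>{1..n}. \<gamma> * R j - c j \<le> \<gamma> * R i - c i)"
    using surplus_le_iff[of \<gamma> "\<gamma> * R i - c i"] surplus_ge[OF True, of \<gamma>] True
    unfolding best_effort_def by auto
  \<comment> \<open>The safety cost cancels between safe actions, so IC among them is
    \<open>best_effort\<close>; IR and IC against unsafe actions remain.\<close>
  have "implements M \<gamma> \<beta> i True \<longleftrightarrow> best_effort \<gamma> i \<and> 0 \<le> \<gamma> * R i - c i - safety_cost M \<and>
     (\<forall>j\<in>{1..n}. (1 - \<beta>) * (1 - \<alpha>) * \<gamma> * R j - c j \<le> \<gamma> * R i - c i - safety_cost M)"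
    unfolding implements_def agent_utility_def best using True assms by (auto simp: all_bool_eq)
  then show ?thesis using safe_at_iff_best[of \<gamma> i] unfolding linear_contract_def by auto
next
  case False
  then show ?thesis using assms unfolding implements_def best_effort_def by auto
qed

text \<open>Only these four fields must agree with the locale, so one interpretation serves the
  original and the changed models.\<close>

lemma optimal_contract_iff:
  assumes "num M = n" "reward M = R" "cost M = c" "side_effect M = \<alpha>"
  shows "optimal_contract M \<gamma> \<beta> \<longleftrightarrow> optimal (safety_cost M) (inspection_cost M) \<gamma> \<beta>"
proof -
  let ?\<kappa> = "safety_cost M" and ?\<iota> = "inspection_cost M"
  note impl = implements_safe_iff[OF assms]
  have safe: "linear_contract g b \<and> (\<exists>i. implements M g b i True) \<longleftrightarrow> safe_at ?\<kappa> g b" for g b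
    using impl best_effort_exists by metis
  have least: "smallest_inspection M \<gamma> \<beta> \<longleftrightarrow> least_safe ?\<kappa> \<gamma> \<beta>"
    unfolding smallest_inspection_def least_safe_def safe[symmetric] by blast
  have util: "principal_utility M g b i True = ereal ((1 - g) * R i - b * ?\<iota>)" for g b i
    using assms unfolding principal_utility_def by simp
  show ?thesis
  proof
    assume L: "optimal_contract M \<gamma> \<beta>"
    then have ls: "least_safe ?\<kappa> \<gamma> \<beta>" using least unfolding optimal_contract_def by blast
    obtain i s where lin: "linear_contract \<gamma> \<beta>" and i: "implements M \<gamma> \<beta> i s"
      and max: "\<And>g b j s'. linear_contract g b \<and> implements M g b j s' \<Longrightarrow>
           principal_utility M g b j s' \<le> principal_utility M \<gamma> \<beta> i s"
      using L unfolding optimal_contract_def utility_maximizing_def by metis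
    have le: "ereal (gross g - b * ?\<iota>) \<le> principal_utility M \<gamma> \<beta> i s" if "safe_at ?\<kappa> g b" for g b
    proof -
      obtain j where j: "best_effort g j" "gross g = (1 - g) * R j" by (rule gross_attained)
      then show ?thesis using max[of g b j True] impl[of g b j] that util by auto
    qed
    \<comment> \<open>An unsafe action yields minus infinity, below the finite value available at
      \<open>\<gamma>\<close>, \<open>\<beta>\<close> itself.\<close>
    have "s" using le[of \<gamma> \<beta>] ls unfolding least_safe_def principal_utility_def
      by (cases s) auto
    with i lin have "best_effort \<gamma> i" using impl by auto
    then have "principal_utility M \<gamma> \<beta> i s \<le> ereal (gross \<gamma> - \<beta> * ?\<iota>)"
      using \<open>s\<close> gross_ge util by auto
    with le have "gross g - b * ?\<iota> \<le> gross \<gamma> - \<beta> * ?\<iota>" if "safe_at ?\<kappa> g b" for g b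
      using that order_trans by (metis ereal_less_eq(3))
    then show "optimal ?\<kappa> ?\<iota> \<gamma> \<beta>" using ls unfolding optimal_def by blast
  next
    assume O: "optimal ?\<kappa> ?\<iota> \<gamma> \<beta>"
    then have safe\<^sub>0: "safe_at ?\<kappa> \<gamma> \<beta>" unfolding optimal_def least_safe_def by blast
    obtain i where i: "best_effort \<gamma> i" "gross \<gamma> = (1 - \<gamma>) * R i" by (rule gross_attained)
    have "principal_utility M g b j s \<le> principal_utility M \<gamma> \<beta> i True"
      if "linear_contract g b \<and> implements M g b j s" for g b j s
    proof (cases s)
      case True
      then have "best_effort g j" "safe_at ?\<kappa> g b" using that impl by auto
      then have "(1 - g) * R j - b * ?\<iota> \<le> gross \<gamma> - \<beta> * ?\<iota>"
        using gross_ge[of g j] O unfolding optimal_def by force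
      then show ?thesis using True i util by simp
    next
      case False
      then show ?thesis by (simp add: principal_utility_def)
    qed
    then have "utility_maximizing M \<gamma> \<beta>"
      using impl[of \<gamma> \<beta> i] i safe\<^sub>0 unfolding utility_maximizing_def by blast
    then show "optimal_contract M \<gamma> \<beta>"
      using O least unfolding optimal_contract_def optimal_def by blast
  qed
qed

end

(* Optimal contracts need not be unique, and when they are not, an inequality between two
   independently chosen optima can fail for the trivial reason that both shares gamma are
   optimal before and after the change.  In each part, the first conjunct compares arbitrary
   optima and states that this is the only exception; the other two conjuncts compare the
   sets of optima. *)
theorem theorem2:
  fixes M :: inspection_model
  assumes "valid_model M" and "assumption1 M" and "assumption2 M"
  shows
    "(\<forall>\<kappa> M'. inspection_cost M < \<kappa> \<and> M' = M\<lparr>inspection_cost := \<kappa>\<rparr> \<longrightarrow>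
        (\<forall>\<gamma> \<beta> \<gamma>' \<beta>'. optimal_contract M \<gamma> \<beta> \<and> optimal_contract M' \<gamma>' \<beta>' \<longrightarrow>
           \<beta>' \<le> \<beta> \<and>
           (\<gamma> \<le> \<gamma>' \<or> optimal_contract M \<gamma>' \<beta>' \<and> optimal_contract M' \<gamma> \<beta>)) \<and>
        (\<forall>\<gamma> \<beta>. optimal_contract M \<gamma> \<beta> \<longrightarrow>
           (\<exists>\<gamma>' \<beta>'. optimal_contract M' \<gamma>' \<beta>' \<and> \<gamma> \<le> \<gamma>' \<and> \<beta>' \<le> \<beta>)) \<and>
        (\<forall>\<gamma>' \<beta>'. optimal_contract M' \<gamma>' \<beta>' \<longrightarrow>
           (\<exists>\<gamma> \<beta>. optimal_contract M \<gamma> \<beta> \<and> \<gamma> \<le> \<gamma>' \<and> \<beta>' \<le> \<beta>)))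
     \<and>
     (\<forall>\<kappa> M'. safety_cost M < \<kappa> \<and> M' = M\<lparr>safety_cost := \<kappa>\<rparr> \<longrightarrow>
        (\<forall>\<gamma> \<beta> \<gamma>' \<beta>'. optimal_contract M \<gamma> \<beta> \<and> optimal_contract M' \<gamma>' \<beta>' \<longrightarrow>
           \<gamma> \<le> \<gamma>' \<or> (\<exists>b. optimal_contract M \<gamma>' b) \<and> (\<exists>b. optimal_contract M' \<gamma> b)) \<and>
        (\<forall>\<gamma> \<beta>. assumption2 M' \<and> optimal_contract M \<gamma> \<beta> \<longrightarrow>
           (\<exists>\<gamma>' \<beta>'. optimal_contract M' \<gamma>' \<beta>' \<and> \<gamma> \<le> \<gamma>')) \<and>
        (\<forall>\<gamma>' \<beta>'. optimal_contract M' \<gamma>' \<beta>' \<longrightarrow>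
           (\<exists>\<gamma> \<beta>. optimal_contract M \<gamma> \<beta> \<and> \<gamma> \<le> \<gamma>')))"
proof -
  interpret effort_menu "num M" "reward M" "cost M" "side_effect M"
    using assms(1) unfolding valid_model_def by unfold_locales auto
  let ?\<kappa> = "safety_cost M" and ?\<iota> = "inspection_cost M"
  have \<iota>: "0 \<le> ?\<iota>" using assms(1) unfolding valid_model_def by auto
  have \<kappa>: "?\<kappa> \<le> surplus 1" using assms(3) unfolding assumption2_def surplus_def by simp
  have opt: "optimal_contract M = optimal ?\<kappa> ?\<iota>"
    by (intro ext optimal_contract_iff) auto
  have opt_I: "optimal_contract (M\<lparr>inspection_cost := k\<rparr>) = optimal ?\<kappa> k" for k
    using optimal_contract_iff[of "M\<lparr>inspection_cost := k\<rparr>"] by (intro ext) auto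
  have opt_S: "optimal_contract (M\<lparr>safety_cost := k\<rparr>) = optimal k ?\<iota>" for k
    using optimal_contract_iff[of "M\<lparr>safety_cost := k\<rparr>"] by (intro ext) auto
  \<comment> \<open>A larger safety cost may leave no safe action implementable, so existence of a
    new optimum needs \<open>assumption2\<close> of the changed model.\<close>
  have A2: "k \<le> surplus 1" if "assumption2 (M\<lparr>safety_cost := k\<rparr>)" for k
    using that unfolding assumption2_def surplus_def by simp
  have I1: "\<beta>' \<le> \<beta> \<and> (\<gamma> \<le> \<gamma>' \<or> optimal ?\<kappa> ?\<iota> \<gamma>' \<beta>' \<and> optimal ?\<kappa> k \<gamma> \<beta>)"
    if "?\<iota> < k" "optimal ?\<kappa> ?\<iota> \<gamma> \<beta>" "optimal ?\<kappa> k \<gamma>' \<beta>'" for k \<gamma> \<beta> \<gamma>' \<beta>'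
    using optimal_inspection_cost_increase[OF that] by blast
  have I2: "\<exists>\<gamma>' \<beta>'. optimal ?\<kappa> k \<gamma>' \<beta>' \<and> \<gamma> \<le> \<gamma>' \<and> \<beta>' \<le> \<beta>"
    if "?\<iota> < k" "optimal ?\<kappa> ?\<iota> \<gamma> \<beta>" for k \<gamma> \<beta>
  proof -
    have "0 \<le> k" using \<iota> that(1) by simp
    from optimal_exists[OF \<kappa> this] obtain \<gamma>' \<beta>' where "optimal ?\<kappa> k \<gamma>' \<beta>'" .
    \<comment> \<open>In the exceptional case of \<open>I1\<close> the old contract is itself
      optimal under the new cost and serves as witness.\<close>
    then show ?thesis using I1[OF that] that(2) by blast
  qed
  have I3: "\<exists>\<gamma> \<beta>. optimal ?\<kappa> ?\<iota> \<gamma> \<beta> \<and> \<gamma> \<le> \<gamma>' \<and> \<beta>' \<le> \<beta>"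
    if "?\<iota> < k" "optimal ?\<kappa> k \<gamma>' \<beta>'" for k \<gamma>' \<beta>'
    using optimal_exists[OF \<kappa> \<iota>] I1[OF that(1) _ that(2)] by (metis order_refl)
  have S1: "\<gamma> \<le> \<gamma>' \<or> (\<exists>b. optimal ?\<kappa> ?\<iota> \<gamma>' b) \<and> (\<exists>b. optimal k ?\<iota> \<gamma> b)"
    if "?\<kappa> < k" "optimal ?\<kappa> ?\<iota> \<gamma> \<beta>" "optimal k ?\<iota> \<gamma>' \<beta>'" for k \<gamma> \<beta> \<gamma>' \<beta>'
    using optimal_safety_cost_increase[OF _ \<iota> that(2,3)] that(1) by simp
  have S2: "\<exists>\<gamma>' \<beta>'. optimal k ?\<iota> \<gamma>' \<beta>' \<and> \<gamma> \<le> \<gamma>'"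
    if "?\<kappa> < k" "k \<le> surplus 1" "optimal ?\<kappa> ?\<iota> \<gamma> \<beta>" for k \<gamma> \<beta>
    using optimal_exists[OF that(2) \<iota>] S1[OF that(1,3)] by (metis order_refl)
  have S3: "\<exists>\<gamma> \<beta>. optimal ?\<kappa> ?\<iota> \<gamma> \<beta> \<and> \<gamma> \<le> \<gamma>'"
    if "?\<kappa> < k" "optimal k ?\<iota> \<gamma>' \<beta>'" for k \<gamma>' \<beta>'
    using optimal_exists[OF \<kappa> \<iota>] S1[OF that(1) _ that(2)] by (metis order_refl)
  show ?thesis (is "?I \<and> ?S")
  proof
    show ?I
    proof (intro allI impI, elim conjE, hypsubst, unfold opt opt_I, intro conjI)
      fix k assume "?\<iota> < k"
      note I = I1[OF this] I2[OF this] I3[OF this]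
      show "\<forall>\<gamma> \<beta> \<gamma>' \<beta>'. optimal ?\<kappa> ?\<iota> \<gamma> \<beta> \<and> optimal ?\<kappa> k \<gamma>' \<beta>' \<longrightarrow>
          \<beta>' \<le> \<beta> \<and> (\<gamma> \<le> \<gamma>' \<or> optimal ?\<kappa> ?\<iota> \<gamma>' \<beta>' \<and> optimal ?\<kappa> k \<gamma> \<beta>)"
        using I(1) by blast
      show "\<forall>\<gamma> \<beta>. optimal ?\<kappa> ?\<iota> \<gamma> \<beta> \<longrightarrow> (\<exists>\<gamma>' \<beta>'. optimal ?\<kappa> k \<gamma>' \<beta>' \<and> \<gamma> \<le> \<gamma>' \<and> \<beta>' \<le> \<beta>)"
        using I(2) by blast
      show "\<forall>\<gamma>' \<beta>'. optimal ?\<kappa> k \<gamma>' \<beta>' \<longrightarrow> (\<exists>\<gamma> \<beta>. optimal ?\<kappa> ?\<iota> \<gamma> \<beta> \<and> \<gamma> \<le> \<gamma>' \<and> \<beta>' \<le> \<beta>)"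
        using I(3) by blast
    qed
    show ?S
    proof (intro allI impI, elim conjE, hypsubst, unfold opt opt_S, intro conjI)
      fix k assume "?\<kappa> < k"
      note S = S1[OF this] S2[OF this A2] S3[OF this]
      show "\<forall>\<gamma> \<beta> \<gamma>' \<beta>'. optimal ?\<kappa> ?\<iota> \<gamma> \<beta> \<and> optimal k ?\<iota> \<gamma>' \<beta>' \<longrightarrow>
          \<gamma> \<le> \<gamma>' \<or> (\<exists>b. optimal ?\<kappa> ?\<iota> \<gamma>' b) \<and> (\<exists>b. optimal k ?\<iota> \<gamma> b)"
        using S(1) by blast
      show "\<forall>\<gamma> \<beta>. assumption2 (M\<lparr>safety_cost := k\<rparr>) \<and> optimal ?\<kappa> ?\<iota> \<gamma> \<beta> \<longrightarrow>
          (\<exists>\<gamma>' \<beta>'. optimal k ?\<iota> \<gamma>' \<beta>' \<and> \<gamma> \<le> \<gamma>')"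
        using S(2) by blast
      show "\<forall>\<gamma>' \<beta>'. optimal k ?\<iota> \<gamma>' \<beta>' \<longrightarrow> (\<exists>\<gamma> \<beta>. optimal ?\<kappa> ?\<iota> \<gamma> \<beta> \<and> \<gamma> \<le> \<gamma>')"
        using S(3) by blast
    qed
  qed
qed

end
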